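(* Let $d\in\mathbb N$ and $\gamma\in\mathbb N$, and let $\mathcal L_*$ be a non-trivial constant-coefficient homogeneous differential operator of order $\gamma$, namely $\mathcal L_*=P(\partial)$ for some $P=\sum_{|\mathbf i|=\gamma}\alpha_{\mathbf i}\mathbf X^{\mathbf i}\in\widetilde{\mathbb P}_\gamma\setminus\{0\}$. Then for any $n\in\mathbb N_0$ the operator $\widetilde{\mathbb P}_{n+\gamma}\to\widetilde{\mathbb P}_n$, $\Pi\mapsto\mathcal L_*\Pi$, is surjective.
   Context: $\mathbb N$ is the set of positive integers and $\mathbb N_0=\mathbb N\cup\{0\}$. $\widetilde{\mathbb P}_l$ is the space of homogeneous polynomials of degree $l$ in $d$ variables over $\mathbb K=\mathbb R$ or $\mathbb C$. For a polynomial $P=\sum\alpha_{\mathbf i}\mathbf X^{\mathbf i}$, $P(\partial)=\sum\alpha_{\mathbf i}\partial^{\mathbf i}$ with $\partial^{\mathbf i}=\partial_{x_1}^{i_1}\cdots\partial_{x_d}^{i_d}$. *)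

theory Defs
  imports Complex_Main "HOL-Library.Poly_Mapping"
begin

text \<open>
  A multi-index is a finitely supported map from variable indices to exponents, and a polynomial
  is a finitely supported map from multi-indices to coefficients; multiplication of polynomials is
  the convolution product of \<^theory>\<open>HOL-Library.Poly_Mapping\<close>.
  The $d$ variables are those with indices $1, \dots, d$.
\<close>

type_synonym multi_index = "nat \<Rightarrow>\<^sub>0 nat"

type_synonym 'k mpoly = "multi_index \<Rightarrow>\<^sub>0 'k"

definition homogeneous_polys :: "nat \<Rightarrow> nat \<Rightarrow> 'k::zero mpoly set" where
  "homogeneous_polys d l =
    {p. \<forall>m \<in> Poly_Mapping.keys p.
          Poly_Mapping.keys m \<subseteq> {1..d} \<and> (\<Sum>i = 1..d. Poly_Mapping.lookup m i) = l}"

text \<open>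
  The subtraction of multi-indices below truncates only when the exponent of the variable is zero,
  in which case the coefficient vanishes.
\<close>

definition partial_deriv :: "nat \<Rightarrow> 'k::comm_semiring_1 mpoly \<Rightarrow> 'k mpoly" where
  "partial_deriv i p =
    (\<Sum>m \<in> Poly_Mapping.keys p.
      Poly_Mapping.single (m - Poly_Mapping.single i 1)
        (of_nat (Poly_Mapping.lookup m i) * Poly_Mapping.lookup p m))"

definition multi_deriv :: "nat \<Rightarrow> multi_index \<Rightarrow> 'k::comm_semiring_1 mpoly \<Rightarrow> 'k mpoly" where
  "multi_deriv d m = foldr (\<lambda>i. partial_deriv i ^^ Poly_Mapping.lookup m i) [1..<Suc d]"

text \<open>
  The operator $P(\partial)$; the factor \<^term>\<open>Poly_Mapping.single 0 c\<close> is the constant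
  polynomial $c$.
\<close>

definition diff_op ::
    "nat \<Rightarrow> 'k::comm_semiring_1 mpoly \<Rightarrow> 'k mpoly \<Rightarrow> 'k mpoly" where
  "diff_op d P p =
    (\<Sum>m \<in> Poly_Mapping.keys P.
      Poly_Mapping.single 0 (Poly_Mapping.lookup P m) * multi_deriv d m p)"

end

theory Submission imports Defs begin

text \<open>
  Over a field of characteristic zero, \<open>P(\<partial>)\<close> is triangular with respect to the
  lexicographic order of multi-indices.
  If \<open>\<mu>\<close> is the largest multi-index occurring in \<open>P\<close>, then applying \<open>P(\<partial>)\<close> to the
  monomial \<open>X^(k + \<mu>)\<close> gives a non-zero multiple of \<open>X^k\<close>, coming from the term \<open>\<mu>\<close>,
  plus multiples of \<open>X^k'\<close> with \<open>k' + m = k + \<mu>\<close> for the other multi-indices \<open>m\<close> of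
  \<open>P\<close>; as \<open>m < \<mu>\<close>, each such \<open>k'\<close> exceeds \<open>k\<close>. There are only finitely many
  multi-indices of a given degree, so downward induction on \<open>k\<close> puts every monomial of degree
  \<open>n\<close> into the image (\<open>single_in_image\<close>), and the image is closed under addition.

  What this rests on is the formula for the derivative of a monomial
  (\<open>multi_deriv_single\<close>): its coefficient is a product of falling factorials, which is
  non-zero exactly if the subtraction of the exponents is a genuine one. In characteristic zero
  this natural number can be inverted in the field, which makes the leading multiple of \<open>X^k\<close>
  non-zero; and a term whose exponents were truncated vanishes, so that it cannot disturb the
  order.
\<close>

section \<open>Monomials and homogeneous polynomials\<close>

definition multi_indices :: "nat \<Rightarrow> nat \<Rightarrow> multi_index set" where
  "multi_indices d n = {m. Poly_Mapping.keys m \<subseteq> {1..d} \<and> (\<Sum>i = 1..d. Poly_Mapping.lookup m i) = n}"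

lemma homogeneous_polys_eq: "homogeneous_polys d n = {p. Poly_Mapping.keys p \<subseteq> multi_indices d n}"
  by (auto simp: homogeneous_polys_def multi_indices_def)

lemma finite_multi_indices: "finite (multi_indices d n)"
proof -
  let ?F = "{f :: nat \<Rightarrow> nat. \<forall>i. (i \<in> {1..d} \<longrightarrow> f i \<in> {..n}) \<and> (i \<notin> {1..d} \<longrightarrow> f i = 0)}"
  have "Poly_Mapping.lookup ` multi_indices d n \<subseteq> ?F"
  proof clarify
    fix m i
    assume m: "m \<in> multi_indices d n"
    have "i \<in> {1..d} \<Longrightarrow> Poly_Mapping.lookup m i \<le> (\<Sum>i = 1..d. Poly_Mapping.lookup m i)"
      by (rule member_le_sum) auto
    with m show "(i \<in> {1..d} \<longrightarrow> Poly_Mapping.lookup m i \<in> {..n}) \<and>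
        (i \<notin> {1..d} \<longrightarrow> Poly_Mapping.lookup m i = 0)"
      by (auto simp: multi_indices_def in_keys_iff subset_iff)
  qed
  moreover have "finite ?F"
    by (rule finite_set_of_finite_funs) auto
  ultimately have "finite (Poly_Mapping.lookup ` multi_indices d n)"
    by (rule finite_subset)
  then show ?thesis
    by (rule finite_imageD) (auto simp: inj_on_def intro: poly_mapping_eqI)
qed

lemma add_in_multi_indices:
  assumes "a \<in> multi_indices d n" and "b \<in> multi_indices d l"
  shows "a + b \<in> multi_indices d (n + l)"
  using assms keys_add[of a b]
  by (auto simp: multi_indices_def lookup_add sum.distrib)

lemma cancel_in_multi_indices:
  assumes "a + b \<in> multi_indices d (n + l)" and "b \<in> multi_indices d l"
  shows "a \<in> multi_indices d n"
proof -
  have "Poly_Mapping.keys a \<subseteq> Poly_Mapping.keys (a + b)"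
    by (auto simp: in_keys_iff lookup_add)
  with assms show ?thesis
    by (auto simp: multi_indices_def lookup_add sum.distrib)
qed

lemma poly_mapping_sum_single:
  "p = (\<Sum>m \<in> Poly_Mapping.keys p. Poly_Mapping.single m (Poly_Mapping.lookup p m))"
proof (rule poly_mapping_eqI)
  fix k
  have "Poly_Mapping.lookup (\<Sum>m \<in> Poly_Mapping.keys p. Poly_Mapping.single m (Poly_Mapping.lookup p m)) k
      = (\<Sum>m \<in> Poly_Mapping.keys p. if m = k then Poly_Mapping.lookup p m else 0)"
    by (simp add: lookup_sum lookup_single when_def)
  also have "\<dots> = Poly_Mapping.lookup p k"
    by (simp add: in_keys_iff)
  finally show "Poly_Mapping.lookup p k =
      Poly_Mapping.lookup (\<Sum>m \<in> Poly_Mapping.keys p. Poly_Mapping.single m (Poly_Mapping.lookup p m)) k"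
    by simp
qed

lemma sum_in_homogeneous_polys:
  assumes "\<And>i. i \<in> A \<Longrightarrow> f i \<in> homogeneous_polys d n"
  shows "sum f A \<in> homogeneous_polys d n"
  using assms
proof (induction A rule: infinite_finite_induct)
  case (insert i A)
  then have "f i \<in> homogeneous_polys d n" and "sum f A \<in> homogeneous_polys d n"
    by auto
  with insert.hyps show ?case
    using keys_add[of "f i" "sum f A"] by (auto simp: homogeneous_polys_eq)
qed (simp_all add: homogeneous_polys_eq)

section \<open>Derivatives of monomials\<close>

lemma partial_deriv_add: "partial_deriv i (p + q) = partial_deriv i p + partial_deriv i q"
  unfolding partial_deriv_def
  by (rule setsum_keys_plus_distrib) (simp_all add: single_add algebra_simps)

lemma partial_deriv_single:
  "partial_deriv i (Poly_Mapping.single k c) =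
    Poly_Mapping.single (k - Poly_Mapping.single i 1) (of_nat (Poly_Mapping.lookup k i) * c)"
  by (simp add: partial_deriv_def)

lemma partial_deriv_pow_add:
  "(partial_deriv i ^^ j) (p + q) = (partial_deriv i ^^ j) p + (partial_deriv i ^^ j) q"
  by (induction j) (simp_all add: partial_deriv_add)

lemma multi_deriv_add: "multi_deriv d m (p + q) = multi_deriv d m p + multi_deriv d m q"
proof -
  have "foldr (\<lambda>i. partial_deriv i ^^ Poly_Mapping.lookup m i) is (p + q) =
      foldr (\<lambda>i. partial_deriv i ^^ Poly_Mapping.lookup m i) is p +
      foldr (\<lambda>i. partial_deriv i ^^ Poly_Mapping.lookup m i) is q" for "is"
    by (induction "is") (simp_all add: partial_deriv_pow_add)
  then show ?thesis
    by (simp add: multi_deriv_def)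
qed

lemma diff_op_add: "diff_op d P (p + q) = diff_op d P p + diff_op d P q"
  by (simp add: diff_op_def multi_deriv_add distrib_left sum.distrib)

definition falling :: "nat \<Rightarrow> nat \<Rightarrow> nat" where
  "falling a j = (\<Prod>l<j. a - l)"

lemma falling_eq_0_iff: "falling a j = 0 \<longleftrightarrow> a < j"
  by (auto simp: falling_def)

lemma partial_deriv_pow_single:
  "(partial_deriv i ^^ j) (Poly_Mapping.single k c) =
    Poly_Mapping.single (k - Poly_Mapping.single i j) (of_nat (falling (Poly_Mapping.lookup k i) j) * c)"
proof (induction j)
  case 0
  show ?case by (simp add: falling_def)
next
  case (Suc j)
  have "k - Poly_Mapping.single i j - Poly_Mapping.single i 1 = k - Poly_Mapping.single i (Suc j)"
    by (simp add: diff_diff_add flip: single_add)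
  with Suc show ?case
    by (simp add: partial_deriv_single lookup_minus falling_def mult_ac)
qed

definition multi_falling :: "nat \<Rightarrow> multi_index \<Rightarrow> multi_index \<Rightarrow> nat" where
  "multi_falling d k m = (\<Prod>i = 1..d. falling (Poly_Mapping.lookup k i) (Poly_Mapping.lookup m i))"

text \<open>
  The partial derivatives act on separate exponents, so each of them still sees the original
  exponent of its variable and the falling factorials multiply.
\<close>

lemma multi_deriv_single:
  assumes "Poly_Mapping.keys m \<subseteq> {1..d}"
  shows "multi_deriv d m (Poly_Mapping.single k c) =
    Poly_Mapping.single (k - m) (of_nat (multi_falling d k m) * c)"
proof -
  let ?S = "\<lambda>A. \<Sum>i\<in>A. Poly_Mapping.single i (Poly_Mapping.lookup m i)"
  have "foldr (\<lambda>i. partial_deriv i ^^ Poly_Mapping.lookup m i) is (Poly_Mapping.single k c) =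
      Poly_Mapping.single (k - ?S (set is))
        (of_nat (\<Prod>i\<in>set is. falling (Poly_Mapping.lookup k i) (Poly_Mapping.lookup m i)) * c)"
    if "distinct is" for "is"
    using that
  proof (induction "is")
    case (Cons i "is")
    have "Poly_Mapping.lookup (?S (set is)) i = 0"
      using Cons.prems by (auto simp: lookup_sum lookup_single when_def intro!: sum.neutral)
    with Cons show ?case
      by (simp add: partial_deriv_pow_single lookup_minus diff_diff_add add_ac mult_ac)
  qed simp
  from this[of "[1..<Suc d]"]
  have "multi_deriv d m (Poly_Mapping.single k c) =
      Poly_Mapping.single (k - ?S {1..d}) (of_nat (multi_falling d k m) * c)"
    by (simp add: multi_deriv_def multi_falling_def atLeastLessThanSuc_atLeastAtMost del: upt_Suc)
  also have "?S {1..d} = ?S (Poly_Mapping.keys m)"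
    using assms by (intro sum.mono_neutral_right) (auto simp: in_keys_iff)
  also have "\<dots> = m"
    by (simp flip: poly_mapping_sum_single)
  finally show ?thesis .
qed

lemma multi_falling_nonzeroD:
  assumes "multi_falling d k m \<noteq> 0" and "Poly_Mapping.keys m \<subseteq> {1..d}"
  shows "k - m + m = k"
proof (rule poly_mapping_eqI)
  fix i
  have "Poly_Mapping.lookup m i \<le> Poly_Mapping.lookup k i"
  proof (cases "i \<in> {1..d}")
    case True
    with assms(1) show ?thesis
      by (auto simp: multi_falling_def falling_eq_0_iff not_less)
  next
    case False
    with assms(2) have "i \<notin> Poly_Mapping.keys m" by blast
    then show ?thesis
      by (simp add: in_keys_iff)
  qed
  then show "Poly_Mapping.lookup (k - m + m) i = Poly_Mapping.lookup k i"
    by (simp add: lookup_add lookup_minus)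
qed

lemma multi_falling_add_nonzero: "multi_falling d (k + m) m \<noteq> 0"
  by (simp add: multi_falling_def falling_eq_0_iff lookup_add)

lemma diff_op_single:
  assumes "P \<in> homogeneous_polys d l"
  shows "diff_op d P (Poly_Mapping.single k c) =
    (\<Sum>m \<in> Poly_Mapping.keys P.
      Poly_Mapping.single (k - m) (Poly_Mapping.lookup P m * (of_nat (multi_falling d k m) * c)))"
  unfolding diff_op_def
  using assms by (intro sum.cong) (auto simp: multi_deriv_single mult_single homogeneous_polys_def)

section \<open>Surjectivity of the operator\<close>

lemma additive_diff_op: "additive (diff_op d P :: 'k::comm_ring_1 mpoly \<Rightarrow> 'k mpoly)"
  by standard (rule diff_op_add)

text \<open>
  A monomial with a truncated exponent would have the wrong degree, but its coefficient is zero.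
\<close>

lemma diff_op_in_homogeneous_polys:
  fixes P :: "'k::comm_ring_1 mpoly"
  assumes P: "P \<in> homogeneous_polys d l" and p: "p \<in> homogeneous_polys d (n + l)"
  shows "diff_op d P p \<in> homogeneous_polys d n"
proof -
  have "diff_op d P (Poly_Mapping.single k c) \<in> homogeneous_polys d n"
    if k: "k \<in> multi_indices d (n + l)" for k and c :: 'k
    unfolding diff_op_single[OF P]
  proof (rule sum_in_homogeneous_polys)
    fix m
    assume "m \<in> Poly_Mapping.keys P"
    with P have m: "m \<in> multi_indices d l"
      by (auto simp: homogeneous_polys_eq)
    have "k - m \<in> multi_indices d n" if "multi_falling d k m \<noteq> 0"
    proof (rule cancel_in_multi_indices[OF _ m])
      show "k - m + m \<in> multi_indices d (n + l)"
        using multi_falling_nonzeroD[OF that] k m by (simp add: multi_indices_def)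
    qed
    then show "Poly_Mapping.single (k - m) (Poly_Mapping.lookup P m * (of_nat (multi_falling d k m) * c))
        \<in> homogeneous_polys d n"
      by (cases "multi_falling d k m = 0") (auto simp: homogeneous_polys_eq)
  qed
  then have "(\<Sum>k \<in> Poly_Mapping.keys p. diff_op d P (Poly_Mapping.single k (Poly_Mapping.lookup p k)))
      \<in> homogeneous_polys d n"
    using p by (intro sum_in_homogeneous_polys) (auto simp: homogeneous_polys_eq)
  then show ?thesis
    by (simp flip: additive.sum[OF additive_diff_op] poly_mapping_sum_single)
qed

text \<open>
  The triangularity argument. All coefficients \<open>c\<close> are treated at once, so that the image is
  only ever used as an additive group.
\<close>

lemma single_in_image:
  fixes P :: "'k::field_char_0 mpoly"
  assumes P: "P \<in> homogeneous_polys d l" and "P \<noteq> 0" and k: "k \<in> multi_indices d n"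
  shows "Poly_Mapping.single k c \<in> diff_op d P ` homogeneous_polys d (n + l)"
  using k
proof (induction "card {k' \<in> multi_indices d n. k < k'}" arbitrary: k c rule: less_induct)
  case less
  let ?K = "Poly_Mapping.keys P"
  define \<mu> where "\<mu> = Max ?K"
  have "?K \<noteq> {}"
    using \<open>P \<noteq> 0\<close> by simp
  then have \<mu>: "\<mu> \<in> ?K"
    by (simp add: \<mu>_def)
  have K: "m \<in> multi_indices d l" if "m \<in> ?K" for m
    using P that by (auto simp: homogeneous_polys_eq)
  have k\<mu>: "k + \<mu> \<in> multi_indices d (n + l)"
    by (rule add_in_multi_indices[OF less.prems K[OF \<mu>]])
  define w where "w m = Poly_Mapping.lookup P m * of_nat (multi_falling d (k + \<mu>) m)" for m
  have w\<mu>: "w \<mu> \<noteq> 0"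
    using \<mu> by (simp add: w_def multi_falling_add_nonzero in_keys_iff)
  \<comment> \<open>scaled so that the term of \<open>\<mu>\<close> contributes exactly \<open>c X^k\<close>\<close>
  define q where "q = Poly_Mapping.single (k + \<mu>) (c / w \<mu>)"
  define t where "t m = Poly_Mapping.single (k + \<mu> - m) (w m * (c / w \<mu>))" for m
  have "diff_op d P q = sum t ?K"
    by (simp add: q_def t_def w_def diff_op_single[OF P] mult.assoc)
  also have "\<dots> = Poly_Mapping.single k c + sum t (?K - {\<mu>})"
    using \<mu> w\<mu> by (simp add: sum.remove t_def)
  finally have q: "Poly_Mapping.single k c = diff_op d P q - sum t (?K - {\<mu>})"
    by simp
  have "t m \<in> diff_op d P ` homogeneous_polys d (n + l)" if m: "m \<in> ?K - {\<mu>}" for m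
  proof (cases "multi_falling d (k + \<mu>) m = 0")
    case True
    then have "t m = diff_op d P 0"
      by (simp add: t_def w_def additive.zero[OF additive_diff_op])
    then show ?thesis
      by (auto simp: homogeneous_polys_eq)
  next
    case False
    define k' where "k' = k + \<mu> - m"
    have k': "k' + m = k + \<mu>"
      using multi_falling_nonzeroD[OF False] K[of m] m by (simp add: k'_def multi_indices_def)
    have k'_in: "k' \<in> multi_indices d n"
      using cancel_in_multi_indices[of k' m d n l] k' k\<mu> K m by simp
    have "m < \<mu>"
      using m by (simp add: \<mu>_def order.strict_iff_order)
    have "k < k'"
    proof (rule ccontr)
      assume "\<not> k < k'"
      then have "k' + m < k + \<mu>"
        using \<open>m < \<mu>\<close> by (intro add_le_less_mono) simp_all
      with k' show False by simp
    qed
    then have "card {j \<in> multi_indices d n. k' < j} < card {j \<in> multi_indices d n. k < j}"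
      using k'_in by (intro psubset_card_mono) (auto simp: finite_multi_indices)
    from less.hyps[OF this k'_in] show ?thesis
      by (simp add: t_def k'_def)
  qed
  then have "\<forall>m \<in> ?K - {\<mu>}. \<exists>r. r \<in> homogeneous_polys d (n + l) \<and> t m = diff_op d P r"
    by blast
  then obtain r where r: "\<And>m. m \<in> ?K - {\<mu>} \<Longrightarrow> r m \<in> homogeneous_polys d (n + l) \<and> t m = diff_op d P (r m)"
    by metis
  have "Poly_Mapping.single k c = diff_op d P (q - sum r (?K - {\<mu>}))"
    unfolding q additive.diff[OF additive_diff_op] additive.sum[OF additive_diff_op]
    using r by simp
  moreover have "sum r (?K - {\<mu>}) \<in> homogeneous_polys d (n + l)"
    using r by (intro sum_in_homogeneous_polys) blast
  then have "q - sum r (?K - {\<mu>}) \<in> homogeneous_polys d (n + l)"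
    using k\<mu> keys_diff[of q "sum r (?K - {\<mu>})"]
    by (auto simp: homogeneous_polys_eq q_def split: if_splits)
  ultimately show ?case by blast
qed

lemma diff_op_image_homogeneous_polys:
  fixes P :: "'k::field_char_0 mpoly"
  assumes P: "P \<in> homogeneous_polys d l" and "P \<noteq> 0"
  shows "diff_op d P ` homogeneous_polys d (n + l) = homogeneous_polys d n"
proof
  show "diff_op d P ` homogeneous_polys d (n + l) \<subseteq> homogeneous_polys d n"
    using diff_op_in_homogeneous_polys[OF P] by blast
  show "homogeneous_polys d n \<subseteq> diff_op d P ` homogeneous_polys d (n + l)"
  proof
    fix p :: "'k mpoly"
    assume "p \<in> homogeneous_polys d n"
    then have "\<forall>k \<in> Poly_Mapping.keys p. \<exists>r. r \<in> homogeneous_polys d (n + l) \<and>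
        Poly_Mapping.single k (Poly_Mapping.lookup p k) = diff_op d P r"
      using single_in_image[OF assms] by (simp add: homogeneous_polys_eq image_iff Bex_def subset_iff)
    then obtain r where r: "\<And>k. k \<in> Poly_Mapping.keys p \<Longrightarrow> r k \<in> homogeneous_polys d (n + l) \<and>
        Poly_Mapping.single k (Poly_Mapping.lookup p k) = diff_op d P (r k)"
      by metis
    have "p = (\<Sum>k \<in> Poly_Mapping.keys p. diff_op d P (r k))"
      using r by (subst poly_mapping_sum_single[of p]) (auto intro!: sum.cong)
    also have "\<dots> = diff_op d P (sum r (Poly_Mapping.keys p))"
      by (simp add: additive.sum[OF additive_diff_op])
    finally show "p \<in> diff_op d P ` homogeneous_polys d (n + l)"
      using r sum_in_homogeneous_polys[of "Poly_Mapping.keys p" r] by blast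
  qed
qed

theorem proposition4:
  fixes d \<gamma> :: nat
  assumes "d \<ge> 1" and "\<gamma> \<ge> 1"
  shows "(\<forall>P :: real mpoly. P \<in> homogeneous_polys d \<gamma> - {0} \<longrightarrow>
            (\<forall>n. diff_op d P ` homogeneous_polys d (n + \<gamma>) = homogeneous_polys d n)) \<and>
         (\<forall>P :: complex mpoly. P \<in> homogeneous_polys d \<gamma> - {0} \<longrightarrow>
            (\<forall>n. diff_op d P ` homogeneous_polys d (n + \<gamma>) = homogeneous_polys d n))"
  by (intro conjI allI impI diff_op_image_homogeneous_polys) simp_all

end
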